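(* Let $\mathbb{F}_q$ be the finite field with $q$ elements, $k\ge 1$, and $a_1,a_2,\ldots,a_k,b\in\mathbb{F}_q$. Let $p(a_1,a_2,\ldots,a_k;k,i)$ be the number of permutations $\tau$ in the symmetric group $S_k$ on $\{1,\ldots,k\}$ having exactly $i$ cycles (fixed points counted as cycles) such that $\sum_{j\in C}a_j=0$ for each cycle $C$ of $\tau$. Then $$N_{\mathbb{F}_q}(a_1,a_2,\ldots,a_k;b)=\frac{1}{q}(q)_k + \frac{v(b)}{q}\sum_{i=1}^k(-1)^{k-i}p(a_1,a_2,\ldots,a_k;k,i)q^i.$$ In particular, if $\sum_{i=1}^k a_i=0$ but $\sum_{i\in I}a_i\neq 0$ for all nonempty $I\subsetneq \{1,2,\ldots,k\}$, then $$N_{\mathbb{F}_q}(a_1,a_2,\ldots,a_k;b)=\frac{1}{q}(q)_k+v(b)(-1)^{k-1}(k-1)!.$$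
   Context: For $a_1,\ldots,a_k,b\in\mathbb{F}_q$, $N_{\mathbb{F}_q}(a_1,\ldots,a_k;b)$ denotes the number of tuples $(x_1,\ldots,x_k)\in\mathbb{F}_q^k$ with $x_i\ne x_j$ for all $i\neq j$ and $a_1x_1+\cdots+a_kx_k=b$. The function $v:\mathbb{F}_q\to\mathbb{Z}$ is defined by $v(b)=-1$ if $b\neq 0$ and $v(0)=q-1$. $(q)_k=q(q-1)\cdots(q-k+1)$ is the falling factorial. *)

theory Defs
  imports
    Complex_Main
    "HOL-Library.FuncSet"
    "HOL-Library.Cardinality"
    "HOL-Computational_Algebra.Primes"
    "HOL-Combinatorics.Orbits"
begin

(* A k-tuple over the field is a function on the index set {1..k}; the coefficient
   family a :: nat => 'a is only ever evaluated on {1..k}. The solutions x are taken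
   extensional, so that distinct elements of the set are distinct tuples. *)

definition distinct_solution_count :: "nat \<Rightarrow> (nat \<Rightarrow> 'a::finite_field) \<Rightarrow> 'a \<Rightarrow> nat" where
  "distinct_solution_count k a b =
     card {x \<in> {1..k} \<rightarrow>\<^sub>E (UNIV :: 'a set).
             (\<forall>i\<in>{1..k}. \<forall>j\<in>{1..k}. i \<noteq> j \<longrightarrow> x i \<noteq> x j) \<and>
             (\<Sum>i=1..k. a i * x i) = b}"

definition v :: "'a::finite_field \<Rightarrow> int" where
  "v b = (if b = 0 then int CARD('a) - 1 else - 1)"

definition falling_factorial :: "int \<Rightarrow> nat \<Rightarrow> int" where
  "falling_factorial q k = (\<Prod>i<k. q - int i)"

(* The cycles of a permutation of {1..k}, as subsets of {1..k}: its orbits there, with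
   the singleton orbits of the fixed points included. *)
definition cycle_sets :: "nat \<Rightarrow> (nat \<Rightarrow> nat) \<Rightarrow> nat set set" where
  "cycle_sets k \<tau> = orbit \<tau> ` {1..k}"

definition zero_sum_perm_count :: "(nat \<Rightarrow> 'a::finite_field) \<Rightarrow> nat \<Rightarrow> nat \<Rightarrow> nat" where
  "zero_sum_perm_count a k i =
     card {\<tau>. \<tau> permutes {1..k} \<and> card (cycle_sets k \<tau>) = i \<and>
              (\<forall>C\<in>cycle_sets k \<tau>. (\<Sum>j\<in>C. a j) = 0)}"

end

theory Submission
  imports Defs
begin

text \<open>
  Summing the sign over the permutations that leave a tuple \<open>x\<close> invariant gives 1 if \<open>x\<close> is
  injective and 0 otherwise, so the number of solutions is the sum over all \<open>\<tau>\<close> of the sign of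
  \<open>\<tau>\<close> times the number of \<open>\<tau>\<close>-invariant solutions. A \<open>\<tau>\<close>-invariant tuple is a free choice of
  one value per cycle, subject to a linear equation whose coefficients are the cycle sums of \<open>a\<close>.
  Such an equation in \<open>c\<close> unknowns has \<open>q ^ (c - 1)\<close> solutions unless all coefficients vanish, in
  which case the count differs from \<open>q ^ (c - 1)\<close> by \<open>v b * q ^ (c - 1)\<close>. The first contributions
  add up to the falling factorial divided by \<open>q\<close>.

  Every sum over permutations is evaluated by adding one point \<open>n\<close> to \<open>S\<close>: the permutations of
  \<open>insert n S\<close> are \<open>transpose n m \<circ> \<sigma>\<close> with \<open>\<sigma>\<close> a permutation of \<open>S\<close>, where \<open>n\<close> is a new fixed
  point if \<open>m = n\<close> and is inserted into the cycle of \<open>m\<close> otherwise.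
\<close>

section \<open>Orbits after the insertion of a point\<close>

text \<open>On \<open>S\<close> the composition differs from \<open>q\<close> only at the
  \<open>q\<close>-preimage of \<open>b\<close>, which now goes to \<open>n\<close>, while
  \<open>n\<close> goes to \<open>b\<close>: the point \<open>n\<close> is spliced in just before
  \<open>b\<close>, and orbits avoiding \<open>b\<close> stay as they are.\<close>

lemma orbit_transpose_insert:
  assumes "finite S" "q permutes S" "n \<notin> S" "b \<in> S" "x \<in> S"
  defines "C \<equiv> orbit q x"
  shows "orbit (transpose n b \<circ> q) x = (if b \<in> C then insert n C else C)"
proof -
  let ?t = "transpose n b \<circ> q" and ?D = "if b \<in> C then insert n C else C"
  have perm: "permutation q"
    using assms by (auto simp: permutation_permutes)
  have CS: "C \<subseteq> S"
    using assms permutes_orbit_subset by metis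
  have qS: "q y \<in> S \<longleftrightarrow> y \<in> S" for y
    using assms permutes_in_image by metis
  have qn: "q n = n"
    using assms by (simp add: permutes_not_in)
  have tn: "?t n = b"
    by (simp add: qn)
  have tq: "?t y = (if q y = b then n else q y)" if "y \<in> S" for y
    using that qS[of y] assms by (auto simp: transpose_def)
  \<comment> \<open>Where \<open>?t\<close> takes the detour through \<open>n\<close>, one further
    step leads from \<open>n\<close> to \<open>b\<close>, so the \<open>?t\<close>-orbit still
    reaches \<open>q y\<close>.\<close>
  have q_step: "q y \<in> orbit ?t z" if "?t y \<in> orbit ?t z" "y \<in> S" for y z
    using that tq[of y] tn orbit.step[of n ?t z] by (auto split: if_splits)
  have sub: "y \<in> orbit ?t x" if "y \<in> C" for y
    using that unfolding C_def
  proof (induction rule: orbit.induct)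
    case base
    then show ?case
      using q_step[of x x] orbit.base[of ?t x] assms by blast
  next
    case (step y)
    then show ?case
      using q_step[of y x] orbit.step[of y ?t x] CS C_def by blast
  qed
  \<comment> \<open>The predecessor \<open>y\<close> of \<open>b\<close> lies on the cycle of
    \<open>b\<close>, and \<open>?t\<close> sends it to \<open>n\<close>.\<close>
  have n_in: "n \<in> orbit ?t x" if "b \<in> C"
  proof -
    obtain y where y: "y \<in> S" "q y = b"
      using assms by (metis permutes_surj qS surjD)
    have "orbit q y = orbit q b"
      using permutation_orbit_step[OF perm, of y] y by simp
    then have "y \<in> orbit q b"
      using permutation_self_in_orbit[OF perm, of y] by simp
    then have "y \<in> C"
      using that unfolding C_def by (rule orbit_trans)
    then have "?t y \<in> orbit ?t x"
      by (intro orbit.step sub)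
    then show ?thesis
      using tq[OF y(1)] y by simp
  qed
  have closed: "?t y \<in> ?D" if "y \<in> ?D" for y
  proof (cases "y = n")
    case True
    then show ?thesis
      using that tn CS assms(3) by (auto split: if_splits)
  next
    case False
    then have "y \<in> C"
      using that by (auto split: if_splits)
    then have "q y \<in> C" "y \<in> S"
      using orbit.step[of y q x] CS by (auto simp: C_def)
    then show ?thesis
      using tq[of y] by auto
  qed
  have x_in: "x \<in> ?D"
    using permutation_self_in_orbit[OF perm, of x] by (auto simp: C_def)
  have "y \<in> ?D" if "y \<in> orbit ?t x" for y
    using that
  proof (induction rule: orbit.induct)
    case base
    show ?case
      using x_in by (rule closed)
  next
    case (step y)
    show ?case
      using step.IH by (rule closed)
  qed
  moreover have "?D \<subseteq> orbit ?t x"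
    using sub n_in by auto
  ultimately show ?thesis
    by blast
qed

text \<open>For \<open>b = n\<close> the transposition is the identity and \<open>{n}\<close> is a
  new orbit. Otherwise \<open>n\<close> joins the orbit of \<open>b\<close>, and deleting
  \<open>n\<close> recovers each old orbit from the new one.\<close>

lemma card_orbits_transpose_insert:
  assumes "finite S" "q permutes S" "n \<notin> S" "b \<in> insert n S"
  shows "card (orbit (transpose n b \<circ> q) ` insert n S) =
    (if b = n then Suc (card (orbit q ` S)) else card (orbit q ` S))"
proof -
  have sub: "orbit q x \<subseteq> S" if "x \<in> S" for x
    using assms that permutes_orbit_subset by metis
  have qn: "q n = n"
    using assms by (simp add: permutes_not_in)
  show ?thesis
  proof (cases "b = n")
    case True
    have "orbit q n = {n}"
      using qn by (simp add: orbit_eq_singleton_iff)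
    moreover have "{n} \<notin> orbit q ` S"
      using sub assms(3) by blast
    ultimately show ?thesis
      using True assms(1) by simp
  next
    case False
    let ?t = "transpose n b \<circ> q"
    define g where "g C = (if b \<in> C then insert n C else C)" for C
    have b: "b \<in> S"
      using False assms by auto
    have "permutation ?t"
      using assms b by (intro permutation_compose permutation_swap_id) (auto simp: permutation_permutes)
    from permutation_orbit_step[OF this, of n] have "orbit ?t n = orbit ?t b"
      by (simp add: qn)
    then have "orbit ?t ` insert n S = orbit ?t ` S"
      using b by auto
    also have "\<dots> = g ` orbit q ` S"
      using orbit_transpose_insert[OF assms(1-3) b] by (auto simp: g_def image_image)
    also have "card \<dots> = card (orbit q ` S)"
    proof (rule card_image, rule inj_on_inverseI)
      fix C assume "C \<in> orbit q ` S"
      then have "n \<notin> C"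
        using sub assms(3) by blast
      then show "g C - {n} = C"
        by (auto simp: g_def)
    qed
    finally show ?thesis
      using False by simp
  qed
qed

section \<open>Signed sums over permutations\<close>

text \<open>This is the sign of \<open>\<tau>\<close>; only its behaviour under the insertion of a point into a cycle is needed.\<close>

definition cycle_sign :: "'b set \<Rightarrow> ('b \<Rightarrow> 'b) \<Rightarrow> int" where
  "cycle_sign S \<tau> = (- 1) ^ (card S + card (orbit \<tau> ` S))"

text \<open>A new fixed point raises both the size and the orbit count; an insertion into a cycle
  raises only the size.\<close>

lemma cycle_sign_transpose_insert:
  assumes "finite S" "q permutes S" "n \<notin> S" "b \<in> insert n S"
  shows "cycle_sign (insert n S) (transpose n b \<circ> q) =
    (if b = n then cycle_sign S q else - cycle_sign S q)"
  unfolding cycle_sign_def card_orbits_transpose_insert[OF assms] using assms by simp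

text \<open>A new fixed point contributes a factor \<open>t\<close> and each of the
  \<open>card S\<close> insertions into a cycle a factor -1, so adding a point to \<open>S\<close>
  multiplies the sum by \<open>t - card S\<close>.\<close>

lemma sum_cycle_sign_power:
  fixes t :: int
  assumes "finite S"
  shows "(\<Sum>\<tau> | \<tau> permutes S. cycle_sign S \<tau> * t ^ card (orbit \<tau> ` S)) = falling_factorial t (card S)"
  using assms
proof (induction S)
  case empty
  then show ?case
    by (simp add: cycle_sign_def falling_factorial_def)
next
  case (insert n S)
  let ?f = "\<lambda>S \<tau>. cycle_sign S \<tau> * t ^ card (orbit \<tau> ` S)"
  have "(\<Sum>\<tau> | \<tau> permutes insert n S. ?f (insert n S) \<tau>)
    = (\<Sum>b\<in>insert n S. \<Sum>q | q permutes S. (if b = n then t else - 1) * ?f S q)"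
    unfolding sum_over_permutations_insert[OF insert.hyps(1,2)] using insert.hyps
    by (intro sum.cong refl) (simp add: card_orbits_transpose_insert cycle_sign_transpose_insert del: image_insert)
  also have "\<dots> = (\<Sum>b\<in>insert n S. (if b = n then t else - 1)) * falling_factorial t (card S)"
    by (simp flip: sum_distrib_left add: insert.IH sum_distrib_right)
  also have "(\<Sum>b\<in>insert n S. (if b = n then t else - 1)) = t - int (card S)"
  proof -
    have "(\<Sum>b\<in>S. (if b = n then t else - 1)) = (\<Sum>b\<in>S. - 1)"
      using insert.hyps by (intro sum.cong) auto
    then show ?thesis
      using insert.hyps by simp
  qed
  finally show ?case
    using insert.hyps by (simp add: falling_factorial_def mult.commute)
qed

text \<open>The stabilizer of \<open>x\<close> is the product of the symmetric groups on its fibres,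
  and the signs cancel once a fibre has two points. In the induction this appears as a factor
  \<open>1 - card {b \<in> S. x b = x n}\<close>.\<close>

lemma sum_cycle_sign_stabilizer:
  assumes "finite S"
  shows "(\<Sum>\<tau> | \<tau> permutes S \<and> (\<forall>i\<in>S. x (\<tau> i) = x i). cycle_sign S \<tau>) = of_bool (inj_on x S)"
proof -
  \<comment> \<open>The constraint moves into the summand, so that the sum runs over all
    permutations and the insertion recursion applies.\<close>
  have "(\<Sum>\<tau> | \<tau> permutes S. of_bool (\<forall>i\<in>S. x (\<tau> i) = x i) * cycle_sign S \<tau>) = of_bool (inj_on x S)"
    using assms
  proof (induction S)
    case empty
    then show ?case
      by (simp add: cycle_sign_def)
  next
    case (insert n S)
    let ?P = "\<lambda>S \<tau>. \<forall>i\<in>S. x (\<tau> i) = x i"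
    \<comment> \<open>Since \<open>q n = n\<close>, invariance at \<open>n\<close> says
      \<open>x b = x n\<close>; swapping \<open>n\<close> and \<open>b\<close> then does not affect
      \<open>x\<close>.\<close>
    have inv: "?P (insert n S) (transpose n b \<circ> q) \<longleftrightarrow> x b = x n \<and> ?P S q"
      if "b \<in> insert n S" "q permutes S" for b q
    proof -
      have qn: "q n = n"
        using that insert.hyps by (simp add: permutes_not_in)
      have "x (transpose n b y) = x y" if "x b = x n" for y
        using that by (simp add: transpose_def)
      then show ?thesis
        by (auto simp: qn)
    qed
    have "(\<Sum>\<tau> | \<tau> permutes insert n S. of_bool (?P (insert n S) \<tau>) * cycle_sign (insert n S) \<tau>)
      = (\<Sum>b\<in>insert n S. \<Sum>q | q permutes S.
          (of_bool (x b = x n) * (if b = n then 1 else - 1)) * (of_bool (?P S q) * cycle_sign S q))"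
      unfolding sum_over_permutations_insert[OF insert.hyps(1,2)]
    proof (intro sum.cong refl)
      fix b q assume *: "b \<in> insert n S" "q \<in> {q. q permutes S}"
      then show "of_bool (?P (insert n S) (transpose n b \<circ> q)) * cycle_sign (insert n S) (transpose n b \<circ> q)
        = (of_bool (x b = x n) * (if b = n then 1 else - 1)) * (of_bool (?P S q) * cycle_sign S q)"
        using inv[of b q] cycle_sign_transpose_insert[of S q n b] insert.hyps by auto
    qed
    also have "\<dots> = (\<Sum>b\<in>insert n S. of_bool (x b = x n) * (if b = n then 1 else - 1)) * of_bool (inj_on x S)"
      by (simp flip: sum_distrib_left add: insert.IH sum_distrib_right)
    also have "(\<Sum>b\<in>insert n S. of_bool (x b = x n) * (if b = n then 1 else - 1))
      = 1 - int (card {b \<in> S. x b = x n})"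
    proof -
      have "(\<Sum>b\<in>S. of_bool (x b = x n) * (if b = n then 1 else - 1)) = (\<Sum>b\<in>S. - of_bool (x b = x n) :: int)"
        using insert.hyps by (intro sum.cong) auto
      also have "\<dots> = - int (card {b \<in> S. x b = x n})"
        using insert.hyps by (simp add: sum_negf Int_def)
      finally show ?thesis
        using insert.hyps by (subst sum.insert) auto
    qed
    \<comment> \<open>If \<open>x\<close> is injective on \<open>S\<close>, at most one
      \<open>b\<close> in \<open>S\<close> has the value \<open>x n\<close>, so the first factor is
      0 or 1. Otherwise both sides vanish.\<close>
    also have "(1 - int (card {b \<in> S. x b = x n})) * of_bool (inj_on x S) = of_bool (inj_on x (insert n S))"
    proof (cases "inj_on x S \<and> x n \<in> x ` S")
      case True
      then obtain b where b: "b \<in> S" "x n = x b" by auto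
      then have "{b \<in> S. x b = x n} = {b}"
        using True by (auto dest: inj_onD)
      then show ?thesis
        using True insert.hyps by auto
    next
      case False
      then show ?thesis
      proof (cases "inj_on x S")
        case True
        with False have notin: "x n \<notin> x ` S"
          by blast
        then have "x b \<noteq> x n" if "b \<in> S" for b
          using that by (metis imageI)
        then have "{b \<in> S. x b = x n} = {}"
          by blast
        then show ?thesis
          using True notin insert.hyps by simp
      qed auto
    qed
    finally show ?case .
  qed
  moreover have "(\<Sum>\<tau> | \<tau> \<in> {\<tau>. \<tau> permutes S} \<and> (\<forall>i\<in>S. x (\<tau> i) = x i). cycle_sign S \<tau>)
    = (\<Sum>\<tau> | \<tau> permutes S. of_bool (\<forall>i\<in>S. x (\<tau> i) = x i) * cycle_sign S \<tau>)"
    unfolding sum.inter_filter[OF finite_permutations[OF assms]]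
    by (intro sum.cong refl) simp
  ultimately show ?thesis
    by simp
qed

section \<open>Permutations with a single orbit\<close>

text \<open>Fixing \<open>n\<close> would leave a second orbit, as \<open>S\<close> is nonempty. So
  \<open>n\<close> goes into the cycle of a one-orbit permutation of \<open>S\<close>, which can be
  done in \<open>card S\<close> ways.\<close>

lemma card_cyclic_permutations:
  assumes "finite S" "S \<noteq> {}"
  shows "card {\<tau>. \<tau> permutes S \<and> card (orbit \<tau> ` S) = 1} = fact (card S - 1)"
proof -
  have eq: "card {\<tau>. \<tau> permutes S \<and> card (orbit \<tau> ` S) = 1}
    = (\<Sum>\<tau> | \<tau> permutes S. of_bool (card (orbit \<tau> ` S) = 1))" if "finite S" for S :: "'a set"
    using finite_permutations[OF that] by (simp add: Int_def)
  show ?thesis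
    unfolding eq[OF assms(1)] using assms
  proof (induction S rule: finite_ne_induct)
    case (singleton n)
    then show ?case by (simp add: permutes_sing)
  next
    case (insert n S)
    have "(\<Sum>\<tau> | \<tau> permutes insert n S. of_bool (card (orbit \<tau> ` insert n S) = 1))
      = (\<Sum>b\<in>insert n S. \<Sum>q | q permutes S. of_bool (b \<noteq> n) * of_bool (card (orbit q ` S) = 1) :: nat)"
      unfolding sum_over_permutations_insert[OF insert.hyps(1,3)]
    proof (intro sum.cong refl)
      fix b q assume *: "b \<in> insert n S" "q \<in> {q. q permutes S}"
      have "card (orbit q ` S) \<noteq> 0"
        using insert.hyps by simp
      then show "of_bool (card (orbit (transpose n b \<circ> q) ` insert n S) = 1)
        = of_bool (b \<noteq> n) * (of_bool (card (orbit q ` S) = 1) :: nat)"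
        using card_orbits_transpose_insert[of S q n b] * insert.hyps by (simp del: image_insert)
    qed
    also have "\<dots> = (\<Sum>b\<in>insert n S. of_bool (b \<noteq> n)) * fact (card S - 1)"
      by (simp only: insert.IH flip: sum_distrib_left sum_distrib_right)
    also have "(\<Sum>b\<in>insert n S. of_bool (b \<noteq> n) :: nat) = card S"
    proof -
      have "S \<inter> {b. b \<noteq> n} = S" using insert.hyps by auto
      then show ?thesis using insert.hyps by simp
    qed
    also have "card S * fact (card S - 1) = fact (card S)"
      using insert.hyps by (subst (2) fact_reduce) (auto simp: card_gt_0_iff)
    finally show ?case
      using insert.hyps by simp
  qed
qed

section \<open>Linear equations and invariant solutions\<close>

text \<open>The factor \<open>CARD('a)\<close> on the left avoids the exponent
  \<open>card I - 1\<close>, which would truncate for empty \<open>I\<close>. If all coefficients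
  vanish, \<open>1 + v b\<close> is the field size or 0; otherwise all right-hand sides have equally
  many solutions.\<close>

lemma card_linear_equation:
  fixes A :: "'b \<Rightarrow> 'a::finite_field"
  assumes "finite I"
  shows "int CARD('a) * int (card {y \<in> I \<rightarrow>\<^sub>E UNIV. (\<Sum>i\<in>I. A i * y i) = b}) =
    (1 + of_bool (\<forall>i\<in>I. A i = 0) * v b) * int CARD('a) ^ card I"
proof -
  let ?Y = "I \<rightarrow>\<^sub>E (UNIV :: 'a set)"
  define F where "F b = {y \<in> ?Y. (\<Sum>i\<in>I. A i * y i) = b}" for b
  have finY: "finite ?Y" and cardY: "card ?Y = CARD('a) ^ card I"
    using assms by (auto intro: finite_PiE simp: card_funcsetE)
  have "int CARD('a) * int (card (F b)) = (1 + of_bool (\<forall>i\<in>I. A i = 0) * v b) * int (card ?Y)"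
  proof (cases "\<forall>i\<in>I. A i = 0")
    case True
    then have "F b = (if b = 0 then ?Y else {})"
      by (auto simp: F_def)
    then show ?thesis
      using True by (simp add: v_def)
  next
    case False
    then obtain j where j: "j \<in> I" "A j \<noteq> 0" by blast
    \<comment> \<open>Dividing by \<open>A j\<close> makes the change of coordinate \<open>j\<close>
      raise the linear form by exactly \<open>c\<close>.\<close>
    have shift: "(\<Sum>i\<in>I. A i * (y(j := y j + c / A j)) i) = (\<Sum>i\<in>I. A i * y i) + c" for y c
    proof -
      have "(\<Sum>i\<in>I. A i * (y(j := y j + c / A j)) i) = (\<Sum>i\<in>I. A i * y i + (if i = j then c else 0))"
        using j by (intro sum.cong) (auto simp: field_simps)
      then show ?thesis
        using j assms by (simp add: sum.distrib)
    qed
    have upd: "y(j := c) \<in> ?Y" if "y \<in> ?Y" for y c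
      using that j(1) by (auto simp: PiE_iff extensional_def)
    have "card (F c) = card (F b)" for c
    proof (rule bij_betw_same_card)
      show "bij_betw (\<lambda>y. y(j := y j + (b - c) / A j)) (F c) (F b)"
      proof (rule bij_betwI[where g = "\<lambda>y. y(j := y j + (c - b) / A j)"])
        show "(\<lambda>y. y(j := y j + (b - c) / A j)) \<in> F c \<rightarrow> F b"
          by (auto simp: F_def shift upd simp del: fun_upd_apply)
        show "(\<lambda>y. y(j := y j + (c - b) / A j)) \<in> F b \<rightarrow> F c"
          by (auto simp: F_def shift upd simp del: fun_upd_apply)
      qed (use j in \<open>auto simp: fun_eq_iff field_simps\<close>)
    qed
    then have "(\<Sum>c\<in>UNIV. card (F c)) = (\<Sum>c\<in>(UNIV :: 'a set). card (F b))"
      by (intro sum.cong refl)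
    then have "CARD('a) * card (F b) = (\<Sum>c\<in>UNIV. card (F c))"
      by simp
    also have "\<dots> = card ?Y"
      using sum.group[OF finY finite[of UNIV] subset_UNIV, where g = "\<lambda>y. \<Sum>i\<in>I. A i * y i" and h = "\<lambda>_. 1 :: nat"] by (simp add: F_def)
    finally show ?thesis
      using False by (simp flip: of_nat_mult)
  qed
  then show ?thesis
    by (simp add: F_def cardY)
qed

text \<open>Invariant functions are constant on orbits, so \<open>h\<close> identifies them with
  functions on the set of orbits; collecting the terms of an orbit \<open>C\<close> gives the
  coefficient \<open>sum a C\<close>.\<close>

lemma card_invariant_solutions:
  fixes a :: "'b \<Rightarrow> 'a::finite_field"
  assumes S: "finite S" and \<tau>: "\<tau> permutes S"
  shows "int CARD('a) * int (card {x \<in> S \<rightarrow>\<^sub>E UNIV. (\<forall>i\<in>S. x (\<tau> i) = x i) \<and> (\<Sum>i\<in>S. a i * x i) = b}) =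
    (1 + of_bool (\<forall>C\<in>orbit \<tau> ` S. sum a C = 0) * v b) * int CARD('a) ^ card (orbit \<tau> ` S)"
proof -
  let ?O = "orbit \<tau> ` S"
  let ?Y = "{y \<in> ?O \<rightarrow>\<^sub>E UNIV. (\<Sum>C\<in>?O. sum a C * y C) = b}"
  let ?X = "{x \<in> S \<rightarrow>\<^sub>E UNIV. (\<forall>i\<in>S. x (\<tau> i) = x i) \<and> (\<Sum>i\<in>S. a i * x i) = b}"
  define h :: "('b set \<Rightarrow> 'a) \<Rightarrow> 'b \<Rightarrow> 'a" where "h y = (\<lambda>i\<in>S. y (orbit \<tau> i))" for y
  have perm: "permutation \<tau>"
    using assms by (auto simp: permutation_permutes)
  have \<tau>S: "\<tau> i \<in> S \<longleftrightarrow> i \<in> S" for i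
    using \<tau> permutes_in_image by metis
  have self: "i \<in> orbit \<tau> i" for i
    by (rule permutation_self_in_orbit[OF perm])
  \<comment> \<open>Distinct orbits are disjoint, so the points with orbit \<open>C\<close> are
    exactly the elements of \<open>C\<close>.\<close>
  have fib: "{i \<in> S. orbit \<tau> i = C} = C" if C: "C \<in> ?O" for C
  proof -
    from C obtain j where "j \<in> S" "C = orbit \<tau> j" by auto
    moreover have "orbit \<tau> i = orbit \<tau> j" if "i \<in> orbit \<tau> j" for i
      using that self by (meson cyclic_on_orbit' orbit_cyclic_eq3 perm)
    ultimately show ?thesis
      using permutes_orbit_subset[OF \<tau>] self by blast
  qed
  have lin: "(\<Sum>i\<in>S. a i * h y i) = (\<Sum>C\<in>?O. sum a C * y C)" for y
  proof -
    have "(\<Sum>i\<in>S. a i * h y i) = (\<Sum>C\<in>?O. \<Sum>i | i \<in> S \<and> orbit \<tau> i = C. a i * h y i)"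
      by (rule sum.group[symmetric]) (use S in auto)
    also have "\<dots> = (\<Sum>C\<in>?O. \<Sum>i\<in>C. a i * y C)"
    proof (rule sum.cong[OF refl])
      fix C assume C: "C \<in> ?O"
      show "(\<Sum>i | i \<in> S \<and> orbit \<tau> i = C. a i * h y i) = (\<Sum>i\<in>C. a i * y C)"
        by (rule sum.cong) (use fib[OF C] in \<open>auto simp: h_def\<close>)
    qed
    finally show ?thesis
      by (simp add: sum_distrib_right)
  qed
  have "bij_betw h ?Y ?X"
  \<comment> \<open>The inverse evaluates \<open>x\<close> at a chosen representative of each orbit;
    by invariance the choice does not matter.\<close>
  proof (rule bij_betwI[where g = "\<lambda>x. \<lambda>C\<in>?O. x (SOME i. i \<in> C)"])
    show "h \<in> ?Y \<rightarrow> ?X"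
    proof
      fix y assume y: "y \<in> ?Y"
      have "h y \<in> S \<rightarrow>\<^sub>E UNIV"
        by (simp add: h_def)
      moreover have "h y (\<tau> i) = h y i" if "i \<in> S" for i
        using that \<tau>S permutation_orbit_step[OF perm] by (simp add: h_def)
      ultimately show "h y \<in> ?X"
        using y lin by simp
    qed
  next
    have const: "x j = x i" if "\<forall>i\<in>S. x (\<tau> i) = x i" "i \<in> S" "j \<in> orbit \<tau> i" for x :: "'b \<Rightarrow> 'a" and i j
      using that(3,1,2)
    proof (induction rule: orbit.induct)
      case (step y)
      then show ?case
        using permutes_orbit_subset[OF \<tau>, of i] by (metis subsetD)
    qed auto
    have hg: "h (\<lambda>C\<in>?O. x (SOME i. i \<in> C)) = x"
      if "x \<in> S \<rightarrow>\<^sub>E UNIV" "\<forall>i\<in>S. x (\<tau> i) = x i" for x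
    proof
      fix i
      show "h (\<lambda>C\<in>?O. x (SOME i. i \<in> C)) i = x i"
      proof (cases "i \<in> S")
        case True
        have "(SOME j. j \<in> orbit \<tau> i) \<in> orbit \<tau> i"
          using self by (rule someI)
        then show ?thesis
          using const[OF that(2) True] True by (simp add: h_def)
      next
        case False
        \<comment> \<open>Outside \<open>S\<close> both functions have the default value
          \<open>undefined\<close>.\<close>
        then show ?thesis
          using that(1) by (auto simp: h_def PiE_def extensional_def)
      qed
    qed
    show "(\<lambda>x. \<lambda>C\<in>?O. x (SOME i. i \<in> C)) \<in> ?X \<rightarrow> ?Y"
    proof
      fix x assume "x \<in> ?X"
      then show "(\<lambda>C\<in>?O. x (SOME i. i \<in> C)) \<in> ?Y"
        using hg[of x] lin[of "\<lambda>C\<in>?O. x (SOME i. i \<in> C)"] by simp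
    qed
    show "h (\<lambda>C\<in>?O. x (SOME i. i \<in> C)) = x" if "x \<in> ?X" for x
      using hg that by simp
    show "(\<lambda>C\<in>?O. h y (SOME i. i \<in> C)) = y" if y: "y \<in> ?Y" for y
    proof
      fix C
      show "(\<lambda>C\<in>?O. h y (SOME i. i \<in> C)) C = y C"
      proof (cases "C \<in> ?O")
        case True
        then have "(SOME i. i \<in> C) \<in> C"
          using self by (metis imageE someI)
        then have "(SOME i. i \<in> C) \<in> S" "orbit \<tau> (SOME i. i \<in> C) = C"
          using fib[OF True] by blast+
        then show ?thesis
          using True by (simp add: h_def)
      next
        case False
        then show ?thesis
          using y by (auto simp: PiE_def extensional_def)
      qed
    qed
  qed
  from bij_betw_same_card[OF this] show ?thesis
    using card_linear_equation[of ?O "sum a" b] S by simp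
qed

section \<open>The count of distinct solutions and the zero-sum permutations\<close>

text \<open>Pairs of a solution \<open>x\<close> and a permutation leaving it invariant are counted
  with sign in two orders: fixing \<open>x\<close> detects injectivity, fixing \<open>\<tau>\<close>
  leaves a linear equation on its orbits.\<close>

lemma card_distinct_solutions:
  fixes a :: "'b \<Rightarrow> 'a::finite_field"
  assumes S: "finite S"
  shows "int CARD('a) * int (card {x \<in> S \<rightarrow>\<^sub>E UNIV. inj_on x S \<and> (\<Sum>i\<in>S. a i * x i) = b}) =
    falling_factorial (int CARD('a)) (card S)
    + v b * (\<Sum>\<tau> | \<tau> permutes S \<and> (\<forall>C\<in>orbit \<tau> ` S. sum a C = 0).
        cycle_sign S \<tau> * int CARD('a) ^ card (orbit \<tau> ` S))"
proof -
  let ?q = "int CARD('a)" and ?P = "{\<tau>. \<tau> permutes S}"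
  let ?X = "{x \<in> S \<rightarrow>\<^sub>E UNIV. (\<Sum>i\<in>S. a i * x i) = b}"
  let ?inv = "\<lambda>\<tau> x. \<forall>i\<in>S. x (\<tau> i) = x i"
  let ?Z = "\<lambda>\<tau>. \<forall>C\<in>orbit \<tau> ` S. sum a C = 0"
  have finP: "finite ?P"
    using finite_permutations[OF S] .
  have finX: "finite ?X"
    using S by (intro finite_subset[of ?X "S \<rightarrow>\<^sub>E UNIV"]) (auto intro: finite_PiE)
  have "int (card {x \<in> S \<rightarrow>\<^sub>E UNIV. inj_on x S \<and> (\<Sum>i\<in>S. a i * x i) = b}) = int (card {x \<in> ?X. inj_on x S})"
    by (intro arg_cong[where f = "\<lambda>A. int (card A)"]) auto
  also have "\<dots> = (\<Sum>x\<in>?X. of_bool (inj_on x S))"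
    using finX by (simp add: Int_def)
  also have "\<dots> = (\<Sum>x\<in>?X. \<Sum>\<tau> | \<tau> \<in> ?P \<and> ?inv \<tau> x. cycle_sign S \<tau>)"
    unfolding mem_Collect_eq sum_cycle_sign_stabilizer[OF S] by (rule refl)
  also have "\<dots> = (\<Sum>\<tau>\<in>?P. \<Sum>x | x \<in> ?X \<and> ?inv \<tau> x. cycle_sign S \<tau>)"
    by (rule sum.swap_restrict[OF finX finP])
  also have "\<dots> = (\<Sum>\<tau>\<in>?P. cycle_sign S \<tau> *
      int (card {x \<in> S \<rightarrow>\<^sub>E UNIV. ?inv \<tau> x \<and> (\<Sum>i\<in>S. a i * x i) = b}))"
    by (intro sum.cong refl) (simp add: conj_ac)
  finally have "?q * int (card {x \<in> S \<rightarrow>\<^sub>E UNIV. inj_on x S \<and> (\<Sum>i\<in>S. a i * x i) = b}) =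
      (\<Sum>\<tau>\<in>?P. cycle_sign S \<tau> *
        (?q * int (card {x \<in> S \<rightarrow>\<^sub>E UNIV. ?inv \<tau> x \<and> (\<Sum>i\<in>S. a i * x i) = b})))"
    by (simp add: sum_distrib_left mult_ac)
  also have "\<dots> = (\<Sum>\<tau>\<in>?P. cycle_sign S \<tau> * ((1 + of_bool (?Z \<tau>) * v b) * ?q ^ card (orbit \<tau> ` S)))"
    by (intro sum.cong refl) (simp add: card_invariant_solutions[OF S])
  \<comment> \<open>The summand 1 gives a sum over all permutations, the falling factorial; the
    indicator keeps only those with zero-sum orbits.\<close>
  also have "\<dots> = (\<Sum>\<tau>\<in>?P. cycle_sign S \<tau> * ?q ^ card (orbit \<tau> ` S))
      + v b * (\<Sum>\<tau>\<in>?P. if ?Z \<tau> then cycle_sign S \<tau> * ?q ^ card (orbit \<tau> ` S) else 0)"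
    unfolding sum_distrib_left sum.distrib[symmetric]
    by (intro sum.cong refl) (auto simp: algebra_simps)
  also have "\<dots> = falling_factorial ?q (card S) + v b * (\<Sum>\<tau> | \<tau> \<in> ?P \<and> ?Z \<tau>.
      cycle_sign S \<tau> * ?q ^ card (orbit \<tau> ` S))"
    by (simp only: sum_cycle_sign_power[OF S] sum.inter_filter[OF finP])
  finally show ?thesis
    by simp
qed

lemma sum_zero_sum_permutations:
  fixes a :: "nat \<Rightarrow> 'a::finite_field" and t :: int
  assumes "k \<ge> 1"
  shows "(\<Sum>\<tau> | \<tau> permutes {1..k} \<and> (\<forall>C\<in>orbit \<tau> ` {1..k}. sum a C = 0).
      cycle_sign {1..k} \<tau> * t ^ card (orbit \<tau> ` {1..k})) =
    (\<Sum>i=1..k. (- 1) ^ (k - i) * int (zero_sum_perm_count a k i) * t ^ i)"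
proof -
  let ?T = "{\<tau>. \<tau> permutes {1..k} \<and> (\<forall>C\<in>orbit \<tau> ` {1..k}. sum a C = 0)}"
  let ?c = "\<lambda>\<tau>. card (orbit \<tau> ` {1..k})"
  have fin: "finite ?T"
    by (rule finite_subset[OF _ finite_permutations[of "{1..k}"]]) auto
  have range: "?c ` ?T \<subseteq> {1..k}"
  proof
    fix i assume "i \<in> ?c ` ?T"
    then obtain \<tau> where i: "i = ?c \<tau>" by blast
    then have "i \<le> k"
      using card_image_le[of "{1..k}" "orbit \<tau>"] by simp
    moreover have "i \<noteq> 0"
      using assms i by simp
    ultimately show "i \<in> {1..k}" by simp
  qed
  have "(\<Sum>\<tau>\<in>?T. cycle_sign {1..k} \<tau> * t ^ ?c \<tau>)
    = (\<Sum>i=1..k. \<Sum>\<tau> | \<tau> \<in> ?T \<and> ?c \<tau> = i. cycle_sign {1..k} \<tau> * t ^ ?c \<tau>)"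
    by (rule sum.group[OF fin finite_atLeastAtMost range, symmetric])
  also have "\<dots> = (\<Sum>i=1..k. (- 1) ^ (k - i) * int (zero_sum_perm_count a k i) * t ^ i)"
  proof (rule sum.cong[OF refl])
    fix i assume i: "i \<in> {1..k}"
    \<comment> \<open>The exponents \<open>k + i\<close> and \<open>k - i\<close> have the same
      parity because \<open>i \<le> k\<close>.\<close>
    have "(\<Sum>\<tau> | \<tau> \<in> ?T \<and> ?c \<tau> = i. cycle_sign {1..k} \<tau> * t ^ ?c \<tau>)
      = (\<Sum>\<tau> | \<tau> \<in> ?T \<and> ?c \<tau> = i. (- 1) ^ (k - i) * t ^ i)"
      using i by (intro sum.cong refl) (auto simp: cycle_sign_def uminus_power_if)
    moreover have "zero_sum_perm_count a k i = card {\<tau>. \<tau> \<in> ?T \<and> ?c \<tau> = i}"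
      unfolding zero_sum_perm_count_def cycle_sets_def by (rule arg_cong[where f = card]) auto
    ultimately show "(\<Sum>\<tau> | \<tau> \<in> ?T \<and> ?c \<tau> = i. cycle_sign {1..k} \<tau> * t ^ ?c \<tau>)
      = (- 1) ^ (k - i) * int (zero_sum_perm_count a k i) * t ^ i"
      by simp
  qed
  finally show ?thesis .
qed

text \<open>Orbits are nonempty, so minimality forces a zero-sum orbit to be all of
  \<open>{1..k}\<close>; the permutations that count are exactly the
  \<open>k\<close>-cycles.\<close>

lemma zero_sum_perm_count_minimal:
  assumes k: "k \<ge> 1" and sum: "(\<Sum>i=1..k. a i) = 0"
    and min: "\<And>I. I \<noteq> {} \<Longrightarrow> I \<subset> {1..k} \<Longrightarrow> (\<Sum>i\<in>I. a i) \<noteq> 0"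
  shows "zero_sum_perm_count a k i = (if i = 1 then fact (k - 1) else 0)"
proof -
  have zero_iff: "(\<forall>C\<in>orbit \<tau> ` {1..k}. sum a C = 0) \<longleftrightarrow> card (orbit \<tau> ` {1..k}) = 1"
    if \<tau>: "\<tau> permutes {1..k}" for \<tau>
  proof
    assume zero: "\<forall>C\<in>orbit \<tau> ` {1..k}. sum a C = 0"
    have "C = {1..k}" if C: "C \<in> orbit \<tau> ` {1..k}" for C
    proof (rule ccontr)
      assume "C \<noteq> {1..k}"
      moreover have "C \<subseteq> {1..k}"
        using C permutes_orbit_subset[OF \<tau>] by blast
      moreover have "C \<noteq> {}"
        using C by (auto simp: orbit_nonempty)
      ultimately show False
        using min[of C] zero C by blast
    qed
    moreover have "orbit \<tau> ` {1..k} \<noteq> {}"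
      using k by simp
    ultimately have "orbit \<tau> ` {1..k} = {{1..k}}"
      by blast
    then show "card (orbit \<tau> ` {1..k}) = 1"
      by simp
  next
    assume "card (orbit \<tau> ` {1..k}) = 1"
    then obtain C where C: "orbit \<tau> ` {1..k} = {C}"
      by (auto simp: card_1_singleton_iff)
    have "permutation \<tau>"
      using \<tau> by (auto simp: permutation_permutes)
    then have "{1..k} \<subseteq> C"
      using permutation_self_in_orbit[of \<tau>] C by (metis imageI singletonD subsetI)
    moreover have "C \<subseteq> {1..k}"
      using permutes_orbit_subset[OF \<tau>] C by (metis imageE insertI1)
    ultimately have "C = {1..k}"
      by simp
    then show "\<forall>C\<in>orbit \<tau> ` {1..k}. sum a C = 0"
      using C sum by simp
  qed
  have "zero_sum_perm_count a k i =
      card {\<tau>. \<tau> permutes {1..k} \<and> card (orbit \<tau> ` {1..k}) = 1 \<and> i = 1}"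
    unfolding zero_sum_perm_count_def cycle_sets_def
    by (rule arg_cong[where f = card]) (use zero_iff in auto)
  then show ?thesis
    using card_cyclic_permutations[of "{1..k}"] k by simp
qed

theorem theorem1p5:
  fixes a :: "nat \<Rightarrow> 'a::finite_field" and b :: 'a and k :: nat
  assumes "k \<ge> 1"
  shows "real (distinct_solution_count k a b) =
           1 / real CARD('a) * real_of_int (falling_factorial (int CARD('a)) k)
           + real_of_int (v b) / real CARD('a) *
             (\<Sum>i=1..k. (- 1) ^ (k - i) * real (zero_sum_perm_count a k i) * real CARD('a) ^ i)
         \<and>
         ((\<Sum>i=1..k. a i) = 0 \<and>
          (\<forall>I. I \<noteq> {} \<and> I \<subset> {1..k} \<longrightarrow> (\<Sum>i\<in>I. a i) \<noteq> 0) \<longrightarrow>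
          real (distinct_solution_count k a b) =
            1 / real CARD('a) * real_of_int (falling_factorial (int CARD('a)) k)
            + real_of_int (v b) * (- 1) ^ (k - 1) * fact (k - 1))"
proof -
  let ?q = "int CARD('a)" and ?N = "distinct_solution_count k a b"
  let ?p = "\<lambda>i. zero_sum_perm_count a k i"
  have "?N = card {x \<in> {1..k} \<rightarrow>\<^sub>E UNIV. inj_on x {1..k} \<and> (\<Sum>i=1..k. a i * x i) = b}"
    unfolding distinct_solution_count_def inj_on_def
    by (rule arg_cong[where f = card]) blast
  then have "?q * int ?N = falling_factorial ?q k + v b * (\<Sum>i=1..k. (- 1) ^ (k - i) * int (?p i) * ?q ^ i)"
    using card_distinct_solutions[of "{1..k}" a b] sum_zero_sum_permutations[OF assms, where a = a and t = ?q] by simp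
  \<comment> \<open>The integer identity moves to the reals, where it can be divided by
    \<open>CARD('a)\<close>.\<close>
  then have "real_of_int (?q * int ?N) =
      real_of_int (falling_factorial ?q k + v b * (\<Sum>i=1..k. (- 1) ^ (k - i) * int (?p i) * ?q ^ i))"
    by (rule arg_cong)
  then have "real CARD('a) * real ?N = real_of_int (falling_factorial ?q k)
      + real_of_int (v b) * (\<Sum>i=1..k. (- 1) ^ (k - i) * real (?p i) * real CARD('a) ^ i)"
    by simp
  then have main: "real ?N = 1 / real CARD('a) * real_of_int (falling_factorial ?q k)
      + real_of_int (v b) / real CARD('a) * (\<Sum>i=1..k. (- 1) ^ (k - i) * real (?p i) * real CARD('a) ^ i)"
    by (simp add: field_simps)
  \<comment> \<open>Only \<open>i = 1\<close> survives, and its factor \<open>CARD('a)\<close>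
    cancels the denominator in \<open>main\<close>.\<close>
  have "(\<Sum>i=1..k. (- 1) ^ (k - i) * real (?p i) * real CARD('a) ^ i)
      = (- 1) ^ (k - 1) * fact (k - 1) * real CARD('a)"
    if "(\<Sum>i=1..k. a i) = 0" "\<forall>I. I \<noteq> {} \<and> I \<subset> {1..k} \<longrightarrow> (\<Sum>i\<in>I. a i) \<noteq> 0"
  proof -
    have "?p i = (if i = 1 then fact (k - 1) else 0)" for i
      using zero_sum_perm_count_minimal[OF assms, of a i] that by blast
    then have "(\<Sum>i=1..k. (- 1) ^ (k - i) * real (?p i) * real CARD('a) ^ i)
      = (\<Sum>i=1..k. if i = 1 then (- 1) ^ (k - 1) * fact (k - 1) * real CARD('a) else 0)"
      by (intro sum.cong) auto
    then show ?thesis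
      using assms by simp
  qed
  with main show ?thesis
    by simp
qed

end
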